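(* Let $\mathcal{H}$ be a real Hilbert space with induced norm $\|\cdot\|$ and let $f:\mathcal{H}\to(-\infty,+\infty]$ be a proper function. Let $T:\mathcal{H}\to\mathcal{H}$ be a continuous operator such that $$T(x)\in \operatorname*{argmin}_{y\in\mathcal{H}}\Big[f(y)+\tfrac12\|x-y\|^2\Big]\neq\varnothing\quad\text{for every }x\in\mathcal{H}.$$ Then, for every $x\in\mathcal{H}$, the function $f+\tfrac12\|x-\cdot\|^2$ has a unique minimizer over $\mathcal{H}$.
   Context: A function $f:\mathcal{H}\to(-\infty,+\infty]$ is proper if its domain $\{x\in\mathcal{H}\mid f(x)<+\infty\}$ is nonempty. Continuity of $T$ is with respect to the norm topology on both sides. No convexity or lower semicontinuity of $f$ is assumed. *)

theory Defs
  imports "HOL-Analysis.Analysis"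
begin

text \<open>
  A function with values in the half-open interval from minus infinity (excluded) to plus infinity
  (included) is an \<^typ>\<open>ereal\<close>-valued function that nowhere takes the value minus infinity;
  the latter is a separate hypothesis and not part of properness.
\<close>

definition effective_domain :: "('a \<Rightarrow> ereal) \<Rightarrow> 'a set" where
  "effective_domain f = {x. f x < \<infinity>}"

definition proper_function :: "('a \<Rightarrow> ereal) \<Rightarrow> bool" where
  "proper_function f \<longleftrightarrow> effective_domain f \<noteq> {}"

text \<open>
  The set of all global minimizers, in contrast to the library's \<^const>\<open>arg_min\<close>,
  which selects one of them.
\<close>

definition argmin_set :: "('a \<Rightarrow> 'b::ord) \<Rightarrow> 'a set" where
  "argmin_set g = {y. is_arg_min g (\<lambda>_. True) y}"

end

theory Submission imports Defs
begin

text \<open>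
  Write \<open>prox x\<close> for the set of minimizers of \<open>f + 1/2 \<parallel>x - \<cdot>\<parallel>\<^sup>2\<close>. Even without convexity of \<open>f\<close>,
  the set-valued map \<open>prox\<close> is monotone: comparing a minimizer at \<open>x\<close> with a minimizer at \<open>x'\<close> in
  both problems and adding, the values of \<open>f\<close> cancel and only the mixed terms of the squared norms
  survive (\<open>proximal_points_monotone\<close>). By Minty's argument, a monotone set-valued map with a
  continuous selection \<open>T\<close> defined on the whole space has no values other than those of \<open>T\<close>
  (\<open>monotone_continuous_selection_unique\<close>): if \<open>p\<close> is a value at \<open>x\<close>, monotonicity between \<open>x\<close> and
  \<open>x + t v\<close> gives \<open>\<langle>v, p - T (x + t v)\<rangle> \<le> 0\<close> for every \<open>t > 0\<close>; letting \<open>t\<close> tend to \<open>0\<close> and choosing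
  \<open>v = p - T x\<close> yields \<open>\<parallel>p - T x\<parallel>\<^sup>2 \<le> 0\<close>.
\<close>

lemma minimizer_of_proper_finite:
  fixes f :: "'a \<Rightarrow> ereal"
  assumes "\<forall>x. f x \<noteq> -\<infinity>" and "proper_function f"
    and "p \<in> argmin_set (\<lambda>y. f y + ereal (c y))"
  shows "\<bar>f p\<bar> \<noteq> \<infinity>"
proof -
  obtain z where z: "f z < \<infinity>"
    using assms(2) by (auto simp: proper_function_def effective_domain_def)
  have "f p + ereal (c p) \<le> f z + ereal (c z)"
    using assms(3) by (auto simp: argmin_set_def is_arg_min_linorder)
  also have "\<dots> < \<infinity>" using z by simp
  finally show ?thesis using assms(1) by auto
qed

text \<open>
  The values of \<open>f\<close> must be finite at both points, since they are to be cancelled from the sum of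
  the two minimality inequalities; this is where properness and the
  exclusion of the value \<open>-\<infinity>\<close> enter.
\<close>

lemma proximal_points_monotone:
  fixes f :: "'a::real_inner \<Rightarrow> ereal"
  assumes "\<forall>x. f x \<noteq> -\<infinity>" and "proper_function f"
    and p: "p \<in> argmin_set (\<lambda>y. f y + ereal ((1/2) * (norm (x - y))\<^sup>2))"
    and q: "q \<in> argmin_set (\<lambda>y. f y + ereal ((1/2) * (norm (x' - y))\<^sup>2))"
  shows "0 \<le> (x - x') \<bullet> (p - q)"
proof -
  obtain a where a: "f p = ereal a"
    using minimizer_of_proper_finite[OF assms(1,2) p] by auto
  obtain b where b: "f q = ereal b"
    using minimizer_of_proper_finite[OF assms(1,2) q] by auto
  have "f p + ereal ((1/2) * (norm (x - p))\<^sup>2) \<le> f q + ereal ((1/2) * (norm (x - q))\<^sup>2)"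
    using p by (auto simp: argmin_set_def is_arg_min_linorder)
  then have 1: "a + (1/2) * (norm (x - p))\<^sup>2 \<le> b + (1/2) * (norm (x - q))\<^sup>2"
    by (simp add: a b)
  have "f q + ereal ((1/2) * (norm (x' - q))\<^sup>2) \<le> f p + ereal ((1/2) * (norm (x' - p))\<^sup>2)"
    using q by (auto simp: argmin_set_def is_arg_min_linorder)
  then have 2: "b + (1/2) * (norm (x' - q))\<^sup>2 \<le> a + (1/2) * (norm (x' - p))\<^sup>2"
    by (simp add: a b)
  show ?thesis
    using 1 2 by (simp add: power2_norm_eq_inner inner_diff_left inner_diff_right inner_commute
        algebra_simps)
qed

lemma monotone_continuous_selection_unique:
  fixes A :: "'a::real_inner \<Rightarrow> 'a set" and T :: "'a \<Rightarrow> 'a"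
  assumes mono: "\<And>x y p q. p \<in> A x \<Longrightarrow> q \<in> A y \<Longrightarrow> 0 \<le> (x - y) \<bullet> (p - q)"
    and sel: "\<And>x. T x \<in> A x"
    and cont: "isCont T x"
    and p: "p \<in> A x"
  shows "p = T x"
proof -
  define v where "v = p - T x"
  define t :: "nat \<Rightarrow> real" where "t n = inverse (real (Suc n))" for n
  have "t \<longlonglongrightarrow> 0"
    unfolding t_def by (rule LIMSEQ_inverse_real_of_nat)
  then have "(\<lambda>n. x + t n *\<^sub>R v) \<longlonglongrightarrow> x + 0 *\<^sub>R v"
    by (intro tendsto_intros)
  then have "(\<lambda>n. T (x + t n *\<^sub>R v)) \<longlonglongrightarrow> T x"
    using isCont_tendsto_compose[OF cont] by simp
  then have lim: "(\<lambda>n. v \<bullet> (p - T (x + t n *\<^sub>R v))) \<longlonglongrightarrow> v \<bullet> (p - T x)"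
    by (intro tendsto_intros)
  have "v \<bullet> (p - T (x + t n *\<^sub>R v)) \<le> 0" for n
  proof -
    have "0 \<le> (x - (x + t n *\<^sub>R v)) \<bullet> (p - T (x + t n *\<^sub>R v))"
      by (rule mono[OF p sel])
    then have "t n * (v \<bullet> (p - T (x + t n *\<^sub>R v))) \<le> 0"
      by simp
    moreover have "0 < t n" by (simp add: t_def)
    ultimately show ?thesis by (simp add: mult_le_0_iff)
  qed
  then have "v \<bullet> (p - T x) \<le> 0"
    by (intro LIMSEQ_le_const2[OF lim]) auto
  then have "v \<bullet> v \<le> 0" unfolding v_def .
  then have "v = 0" using inner_gt_zero_iff[of v] by linarith
  then show ?thesis by (simp add: v_def)
qed

theorem proposition1:
  fixes f :: "'a::{real_inner, complete_space} \<Rightarrow> ereal"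
    and T :: "'a \<Rightarrow> 'a"
  assumes "\<forall>x. f x \<noteq> -\<infinity>"
    and "proper_function f"
    and "continuous_on UNIV T"
    and "\<forall>x. T x \<in> argmin_set (\<lambda>y. f y + ereal ((1/2) * (norm (x - y))\<^sup>2))"
  shows "\<forall>x. \<exists>!y. y \<in> argmin_set (\<lambda>y. f y + ereal ((1/2) * (norm (x - y))\<^sup>2))"
proof
  fix x
  define prox where "prox = (\<lambda>x. argmin_set (\<lambda>y. f y + ereal ((1/2) * (norm (x - y))\<^sup>2)))"
  have sel: "T z \<in> prox z" for z
    using assms(4) by (simp add: prox_def)
  have mono: "0 \<le> (w - z) \<bullet> (p - q)" if "p \<in> prox w" "q \<in> prox z" for w z p q
    using proximal_points_monotone[OF assms(1,2)] that unfolding prox_def by blast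
  have cont: "isCont T x"
    using assms(3) by (simp add: continuous_on_eq_continuous_at)
  have "\<exists>!y. y \<in> prox x"
  proof
    show "T x \<in> prox x" by (rule sel)
    show "p = T x" if "p \<in> prox x" for p
      using monotone_continuous_selection_unique[of prox T x p, OF mono sel cont that] .
  qed
  then show "\<exists>!y. y \<in> argmin_set (\<lambda>y. f y + ereal ((1/2) * (norm (x - y))\<^sup>2))"
    by (simp add: prox_def)
qed

end
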